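(* There exists no normalised (no-signaling) pure assemblage with $d=s=r=2$ that can be transformed, by stochastic 1W-LOCCs, into every normalised assemblage with $d=s=r=2$. That is, for every pure assemblage $\Psi_{A|X}$ with $d=s=r=2$ there is a normalised assemblage with $d=s=r=2$ into which $\Psi_{A|X}$ cannot be transformed by any stochastic 1W-LOCC.
   Context: Notation: $[n]=\{0,\dots,n-1\}$. All index sets are finite and all Hilbert spaces finite-dimensional. Assemblages. Fix natural numbers $d,r,s\ge1$ and $\mathcal{H}_B=\mathbb{C}^d$. A (no-signaling) assemblage with parameters $(d,r,s)$ is a family $\rho_{A|X}=\{\varrho_{A|X}(a,x)\}_{a\in[r],x\in[s]}$ of positive semidefinite operators on $\mathcal{H}_B$ such that $\varrho_B:=\sum_a\varrho_{A|X}(a,x)$ does not depend on $x$; it is normalised if $\mathrm{Tr}[\varrho_B]=1$. A normalised assemblage is also written $\{P_{A|X}(a,x),\varrho(a,x)\}_{a,x}$, with $P_{A|X}(\cdot,x)$ a probability distribution over $a$ for each $x$, $\varrho(a,x)$ density operators, and $\varrho_{A|X}(a,x)=P_{A|X}(a,x)\,\varrho(a,x)$. It is a pure assemblage if every $\varrho(a,x)$ is of the form $|\psi(a,x)\rangle\langle\psi(a,x)|$ for a unit vector $|\psi(a,x)\rangle\in\mathcal{H}_B$. Stochastic 1W-LOCCs. A stochastic 1W-LOCC $\mathcal{M}$ from assemblages with parameters $(d,r,s)$ to assemblages with parameters $(d_f,r_f,s_f)$ is specified by a finite set of $\omega$'s, operators $K_\omega:\mathbb{C}^d\to\mathbb{C}^{d_f}$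 with $\sum_\omega K_\omega^\dagger K_\omega\le\mathbb{1}$, and normalised conditional probability distributions $P(x|x_f,\omega)$ and $P(a_f|a,x,\omega,x_f)$ ($x\in[s]$, $x_f\in[s_f]$, $a\in[r]$, $a_f\in[r_f]$). It maps $\rho_{A|X}$ to the (possibly unnormalised) assemblage with components $$[\mathcal{M}(\rho_{A|X})](a_f,x_f)=\sum_{\omega,a,x}P(x|x_f,\omega)P(a_f|a,x,\omega,x_f)\,K_\omega\,\varrho_{A|X}(a,x)\,K_\omega^\dagger .$$ A normalised assemblage $\rho_{A|X}$ can be transformed into a normalised assemblage $\rho'_{A_f|X_f}$ by a stochastic 1W-LOCC if there exist such an $\mathcal{M}$ and a real $p>0$ with $\mathcal{M}(\rho_{A|X})=p\,\rho'_{A_f|X_f}$ (componentwise). *)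

theory Defs
  imports "HOL-Analysis.Analysis" "HOL-Probability.Probability_Mass_Function"
begin

(* Operators from C^d to C^e are matrices of type complex^'d^'e ('e rows, 'd columns). *)

definition hadjoint :: "complex^'n^'m \<Rightarrow> complex^'m^'n" where
  "hadjoint A = (\<chi> i j. cnj (A $ j $ i))"

definition hinner :: "complex^'n \<Rightarrow> complex^'n \<Rightarrow> complex" where
  "hinner v w = (\<Sum>i\<in>UNIV. cnj (v $ i) * w $ i)"

definition ketbra :: "complex^'n \<Rightarrow> complex^'n^'n" where
  "ketbra \<psi> = (\<chi> i j. \<psi> $ i * cnj (\<psi> $ j))"

(* Over the complex numbers this condition already forces A to be Hermitian. *)
definition psd :: "complex^'n^'n \<Rightarrow> bool" where
  "psd A \<longleftrightarrow> (\<forall>v. hinner v (A *v v) \<in> \<real>\<^sub>\<ge>\<^sub>0)"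

definition density_operator :: "complex^'n^'n \<Rightarrow> bool" where
  "density_operator \<rho> \<longleftrightarrow> psd \<rho> \<and> trace \<rho> = 1"

(* An assemblage with parameters (d, r, s) has d = CARD('n), r = CARD('a), s = CARD('x);
   the first argument is the outcome a, the second one the input x. *)
type_synonym ('a, 'x, 'n) family = "'a \<Rightarrow> 'x \<Rightarrow> complex^'n^'n"

definition assemblage :: "('a::finite, 'x::finite, 'n::finite) family \<Rightarrow> bool" where
  "assemblage E \<longleftrightarrow> (\<forall>a x. psd (E a x)) \<and> (\<forall>x x'. (\<Sum>a\<in>UNIV. E a x) = (\<Sum>a\<in>UNIV. E a x'))"

definition normalised_assemblage :: "('a::finite, 'x::finite, 'n::finite) family \<Rightarrow> bool" where
  "normalised_assemblage E \<longleftrightarrow> assemblage E \<and> (\<forall>x. trace (\<Sum>a\<in>UNIV. E a x) = 1)"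

(* The form {P(a,x), rho(a,x)} of a family E. If P(a,x) = 0, then rho(a,x) is an
   arbitrary density operator, not determined by E. *)
definition ensemble_form ::
    "('a::finite, 'x::finite, 'n::finite) family \<Rightarrow> ('x \<Rightarrow> 'a pmf) \<Rightarrow> ('a, 'x, 'n) family \<Rightarrow> bool" where
  "ensemble_form E P \<rho> \<longleftrightarrow>
     (\<forall>a x. density_operator (\<rho> a x) \<and> E a x = pmf (P x) a *\<^sub>R \<rho> a x)"

definition pure_assemblage :: "('a::finite, 'x::finite, 'n::finite) family \<Rightarrow> bool" where
  "pure_assemblage E \<longleftrightarrow> normalised_assemblage E \<and>
     (\<exists>P \<rho>. ensemble_form E P \<rho> \<and> (\<forall>a x. \<exists>\<psi>. norm \<psi> = 1 \<and> \<rho> a x = ketbra \<psi>))"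

(* PX xf \<omega> is P(. | xf, \<omega>) and PA a x \<omega> xf is P(. | a, x, \<omega>, xf). *)
definition locc_map ::
    "nat set \<Rightarrow> (nat \<Rightarrow> complex^'n^'m) \<Rightarrow> ('y \<Rightarrow> nat \<Rightarrow> 'x pmf) \<Rightarrow>
     ('a \<Rightarrow> 'x \<Rightarrow> nat \<Rightarrow> 'y \<Rightarrow> 'b pmf) \<Rightarrow>
     ('a::finite, 'x::finite, 'n::finite) family \<Rightarrow> ('b::finite, 'y::finite, 'm::finite) family" where
  "locc_map \<Omega> K PX PA E = (\<lambda>b y. \<Sum>\<omega>\<in>\<Omega>. \<Sum>a\<in>UNIV. \<Sum>x\<in>UNIV.
     (pmf (PX y \<omega>) x * pmf (PA a x \<omega> y) b) *\<^sub>R (K \<omega> ** E a x ** hadjoint (K \<omega>)))"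

(* The labels \<omega> are natural numbers, which represent every finite set of labels. *)
definition stochastic_1W_LOCC ::
    "(('a::finite, 'x::finite, 'n::finite) family \<Rightarrow> ('b::finite, 'y::finite, 'm::finite) family) \<Rightarrow> bool" where
  "stochastic_1W_LOCC M \<longleftrightarrow> (\<exists>\<Omega> K PX PA.
     finite \<Omega> \<and> psd (mat 1 - (\<Sum>\<omega>\<in>\<Omega>. hadjoint (K \<omega>) ** K \<omega>)) \<and> M = locc_map \<Omega> K PX PA)"

definition transformable ::
    "('a::finite, 'x::finite, 'n::finite) family \<Rightarrow> ('b::finite, 'y::finite, 'm::finite) family \<Rightarrow> bool" where
  "transformable E F \<longleftrightarrow> (\<exists>M p. stochastic_1W_LOCC M \<and> (0::real) < p \<and>
     (\<forall>b y. M E b y = p *\<^sub>R F b y))"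

end

theory Submission
  imports Defs
begin

text \<open>
  Four pairwise independent lines of a pure assemblage have a cross ratio, which invertible Kraus
  operators preserve; relabelling outcomes or inputs can at most invert it. If the target is a pure
  assemblage whose lines for one input differ from those for the other input, then positivity forces
  every Kraus operator with a nonzero contribution to carry the lines of the source onto those of the target,
  respecting the pairing by inputs. Two targets with cross ratios \<open>-1\<close> and \<open>-4\<close> therefore cannot both
  be reached from the same source.
\<close>

section \<open>Brackets, quadratic forms and rank-one operators\<close>

text \<open>The determinant with columns \<open>u\<close> and \<open>v\<close>, an algebraic test
  for linear dependence.\<close>

definition bracket :: "complex^2 \<Rightarrow> complex^2 \<Rightarrow> complex" where
  "bracket u v = u $ 1 * v $ 2 - u $ 2 * v $ 1"

text \<open>The quadratic form of \<open>M\<close> at the vector \<open>(- cnj (u $ 2), cnj (u $ 1))\<close>, which is orthogonal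
  to \<open>u\<close>.\<close>

definition qform :: "complex^2 \<Rightarrow> complex^2^2 \<Rightarrow> real" where
  "qform u M = Re (u $ 2 * cnj (u $ 2) * M $ 1 $ 1 - u $ 2 * cnj (u $ 1) * M $ 1 $ 2
     - u $ 1 * cnj (u $ 2) * M $ 2 $ 1 + u $ 1 * cnj (u $ 1) * M $ 2 $ 2)"

lemma bracket_scale: "bracket (c *s u) (d *s v) = c * d * bracket u v"
  by (simp add: bracket_def algebra_simps)

lemma bracket_zero_right [simp]: "bracket u 0 = 0"
  by (simp add: bracket_def)

lemma bracket_self [simp]: "bracket u u = 0"
  by (simp add: bracket_def)

lemma bracket_swap: "bracket v u = - bracket u v"
  by (simp add: bracket_def)

lemma bracket_matrix_vector: "bracket (K *v u) (K *v v) = det K * bracket u v"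
  by (simp add: bracket_def det_2 matrix_vector_mult_def sum_2 algebra_simps)

lemma bracket_eq_0_imp_parallel:
  assumes "bracket u w = 0" "u \<noteq> 0"
  obtains c where "w = c *s u"
proof (cases "u $ 1 = 0")
  case True
  then have "u $ 2 \<noteq> 0" using assms(2) by (simp add: vec_eq_iff forall_2)
  with True assms(1) have "w = (w $ 2 / u $ 2) *s u"
    by (simp add: vec_eq_iff forall_2 bracket_def)
  then show ?thesis by (rule that)
next
  case False
  with assms(1) have "w = (w $ 1 / u $ 1) *s u"
    by (simp add: vec_eq_iff forall_2 bracket_def field_simps)
  then show ?thesis by (rule that)
qed

lemma qform_add: "qform u (M + N) = qform u M + qform u N"
  by (simp add: qform_def algebra_simps)

lemma qform_scaleR: "qform u (t *\<^sub>R M) = t * qform u M"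
  unfolding qform_def by (simp add: algebra_simps scaleR_conv_of_real[where 'a=complex])

lemma qform_zero [simp]: "qform u 0 = 0"
  by (simp add: qform_def)

lemma qform_sum: "qform u (sum M S) = (\<Sum>i\<in>S. qform u (M i))"
  by (induction S rule: infinite_finite_induct) (simp_all add: qform_add)

text \<open>The inner product of the orthogonal vector behind \<open>qform u\<close> with
  \<open>w\<close> is exactly \<open>bracket u w\<close>.\<close>

lemma qform_ketbra: "qform u (ketbra w) = (cmod (bracket u w))\<^sup>2"
proof -
  have "complex_of_real ((cmod (bracket u w))\<^sup>2) = bracket u w * cnj (bracket u w)"
    by (rule complex_norm_square)
  then have "(cmod (bracket u w))\<^sup>2 = Re (bracket u w * cnj (bracket u w))"
    by (metis Re_complex_of_real)
  then show ?thesis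
    by (simp add: qform_def ketbra_def bracket_def algebra_simps)
qed

lemma matrix_add_rdistrib: "(A + B) ** C = A ** C + B ** (C :: 'a::semiring_1^'n^'m)"
  by (simp add: matrix_matrix_mult_def vec_eq_iff distrib_right sum.distrib)

lemma conjugate_ketbra: "K ** ketbra v ** hadjoint K = ketbra (K *v v)"
proof -
  have "(\<Sum>k\<in>UNIV. (\<Sum>l\<in>UNIV. K $ i $ l * (v $ l * cnj (v $ k))) * cnj (K $ j $ k))
      = (\<Sum>l\<in>UNIV. K $ i $ l * v $ l) * (\<Sum>k\<in>UNIV. cnj (K $ j $ k) * cnj (v $ k))" for i j
    by (simp add: sum_distrib_left sum_distrib_right mult_ac)
  then show ?thesis
    by (simp add: vec_eq_iff ketbra_def hadjoint_def matrix_matrix_mult_def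
        matrix_vector_mult_def)
qed

lemma ketbra_scale: "ketbra (of_real c *s v) = (c\<^sup>2) *\<^sub>R ketbra v"
  by (simp add: vec_eq_iff ketbra_def power2_eq_square scaleR_conv_of_real[where 'a=complex] mult_ac)

lemma scaleR_ketbra: "t \<ge> 0 \<Longrightarrow> t *\<^sub>R ketbra v = ketbra (of_real (sqrt t) *s v)"
  by (simp add: ketbra_scale)

lemma psd_ketbra: "psd (ketbra (v :: complex^'n))"
  unfolding psd_def
proof
  fix u :: "complex^'n"
  have "hinner u (ketbra v *v u) = hinner u v * cnj (hinner u v)"
    by (simp add: hinner_def ketbra_def matrix_vector_mult_def sum_product sum_distrib_left mult_ac)
  then show "hinner u (ketbra v *v u) \<in> \<real>\<^sub>\<ge>\<^sub>0"
    by (simp add: complex_nonneg_Reals_iff)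
qed

text \<open>Each probability goes into its state vector as a square root, so \<open>v a x\<close>
  need not be normalised and may be zero.\<close>

lemma pure_assemblageE:
  assumes "pure_assemblage (E :: ('a::finite, 'x::finite, 'n::finite) family)"
  obtains v where "\<And>a x. E a x = ketbra (v a x)"
proof -
  obtain P \<rho> where E: "ensemble_form E P \<rho>" and \<rho>: "\<forall>a x. \<exists>\<psi>. norm \<psi> = 1 \<and> \<rho> a x = ketbra \<psi>"
    using assms unfolding pure_assemblage_def by blast
  obtain \<psi> where \<psi>: "\<And>a x. \<rho> a x = ketbra (\<psi> a x)"
    using \<rho> by metis
  have "E a x = ketbra (of_real (sqrt (pmf (P x) a)) *s \<psi> a x)" for a x
    using E by (simp add: ensemble_form_def ketbra_scale \<psi>)
  then show ?thesis by (rule that)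
qed

lemma pmf_pos_exists: "\<exists>i. pmf p i > 0"
  by (metis pmf_positive set_pmf_not_empty all_not_in_conv)

section \<open>Cross ratios under stochastic 1W-LOCCs\<close>

text \<open>The numerator and the denominator of the cross ratio are kept apart, so that outcome swaps just
  exchange them and no division is needed.\<close>

definition cross1 :: "(2 \<Rightarrow> 2 \<Rightarrow> complex^2) \<Rightarrow> complex" where
  "cross1 v = bracket (v 1 1) (v 1 2) * bracket (v 2 1) (v 2 2)"

definition cross2 :: "(2 \<Rightarrow> 2 \<Rightarrow> complex^2) \<Rightarrow> complex" where
  "cross2 v = bracket (v 1 1) (v 2 2) * bracket (v 2 1) (v 1 2)"

lemma cross_matrix_vector:
  "cross1 (\<lambda>a x. K *v v a x) = (det K)\<^sup>2 * cross1 v"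
  "cross2 (\<lambda>a x. K *v v a x) = (det K)\<^sup>2 * cross2 v"
  by (simp_all add: cross1_def cross2_def bracket_matrix_vector power2_eq_square)

text \<open>Each of the four vectors occurs once in either product, whence the common factor
  \<open>k\<close>. Swapping the outcomes of one input exchanges the products; swapping the inputs
  reverses both brackets in each, and the signs cancel.\<close>

lemma cross_relabel:
  fixes w \<phi> :: "2 \<Rightarrow> 2 \<Rightarrow> complex^2"
  assumes w: "\<And>a y. w a (\<xi> y) = c a y *s \<phi> (\<beta> a y) y"
    and \<xi>: "\<xi> 1 \<noteq> \<xi> 2" and \<beta>: "\<And>y. \<beta> 1 y \<noteq> \<beta> 2 y"
  defines "k \<equiv> c 1 1 * c 2 1 * c 1 2 * c 2 2"
  shows "cross1 w = k * cross1 \<phi> \<and> cross2 w = k * cross2 \<phi> \<or>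
         cross1 w = k * cross2 \<phi> \<and> cross2 w = k * cross1 \<phi>"
proof -
  have two: "i = 1 \<and> j = 2 \<or> i = 2 \<and> j = 1" if "i \<noteq> j" for i j :: 2
    using that exhaust_2[of i] exhaust_2[of j] by auto
  have \<xi>c: "\<xi> 1 = 1 \<and> \<xi> 2 = 2 \<or> \<xi> 1 = 2 \<and> \<xi> 2 = 1"
    using two[OF \<xi>] .
  have w': "w 1 (\<xi> 1) = c 1 1 *s \<phi> (\<beta> 1 1) 1" "w 2 (\<xi> 1) = c 2 1 *s \<phi> (\<beta> 2 1) 1"
    "w 1 (\<xi> 2) = c 1 2 *s \<phi> (\<beta> 1 2) 2" "w 2 (\<xi> 2) = c 2 2 *s \<phi> (\<beta> 2 2) 2"
    using w by auto
  have sw: "bracket (\<phi> i 2) (\<phi> j 1) = - bracket (\<phi> j 1) (\<phi> i 2)" for i j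
    by (rule bracket_swap)
  show ?thesis
    using \<xi>c two[OF \<beta>[of 1]] two[OF \<beta>[of 2]]
    by (elim disjE conjE; insert w'; simp add: cross1_def cross2_def bracket_scale k_def sw)
qed

text \<open>The proof takes for \<open>k\<close> the squared determinant of one Kraus operator and
  for \<open>l\<close> the product of the scalars relating its images to the target vectors. Both
  products of \<open>\<phi>\<close> are nonzero, so \<open>l \<noteq> 0\<close> also excludes
  \<open>k = 0\<close>.\<close>

theorem cross_ratio_invariant:
  fixes E F :: "(2, 2, 2) family"
  assumes E: "assemblage E" and v: "\<And>a x. E a x = ketbra (v a x)"
    and F: "\<And>b y. F b y = t b y *\<^sub>R ketbra (\<phi> b y)" and t: "\<And>b y. t b y > 0"
    and \<phi>: "\<And>b b' y y'. y \<noteq> y' \<Longrightarrow> bracket (\<phi> b y) (\<phi> b' y') \<noteq> 0"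
    and tr: "transformable E F"
  obtains k l where "l \<noteq> 0"
    "k * cross1 v = l * cross1 \<phi> \<and> k * cross2 v = l * cross2 \<phi> \<or>
     k * cross1 v = l * cross2 \<phi> \<and> k * cross2 v = l * cross1 \<phi>"
proof -
  have ex_other: "\<exists>y'. y' \<noteq> y" for y :: 2
    using exhaust_2[of y] by (metis zero_neq_one)
  obtain \<Omega> K PX PA p where fin: "finite \<Omega>" and p: "0 < p"
    and M: "\<And>b y. locc_map \<Omega> K PX PA E b y = p *\<^sub>R F b y"
    using tr unfolding transformable_def stochastic_1W_LOCC_def by blast
  define W where "W \<omega> a x = K \<omega> *v v a x" for \<omega> a x
  define wt where "wt y b \<omega> a x = pmf (PX y \<omega>) x * pmf (PA a x \<omega> y) b" for y b \<omega> a x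
  have wt_nonneg: "wt y b \<omega> a x \<ge> 0" for y b \<omega> a x
    by (simp add: wt_def)
  have sum_eq: "(\<Sum>\<omega>\<in>\<Omega>. \<Sum>a\<in>UNIV. \<Sum>x\<in>UNIV. wt y b \<omega> a x * (cmod (bracket u (W \<omega> a x)))\<^sup>2)
      = p * t b y * (cmod (bracket u (\<phi> b y)))\<^sup>2" for y b u
  proof -
    have "qform u (locc_map \<Omega> K PX PA E b y) = qform u (p *\<^sub>R F b y)"
      by (simp add: M)
    then show ?thesis
      by (simp add: locc_map_def F v conjugate_ketbra qform_sum qform_scaleR qform_ketbra
          W_def wt_def mult.assoc)
  qed
  \<comment> \<open>At \<open>u = \<phi> b y\<close> the right-hand side of \<open>sum_eq\<close>
    vanishes, hence so does every nonnegative summand.\<close>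
  have par0: "bracket (\<phi> b y) (W \<omega> a x) = 0" if "\<omega> \<in> \<Omega>" "wt y b \<omega> a x > 0" for \<omega> a x b y
  proof -
    have "(\<Sum>\<omega>\<in>\<Omega>. \<Sum>a\<in>UNIV. \<Sum>x\<in>UNIV. wt y b \<omega> a x * (cmod (bracket (\<phi> b y) (W \<omega> a x)))\<^sup>2) = 0"
      by (simp add: sum_eq)
    then have "wt y b \<omega> a x * (cmod (bracket (\<phi> b y) (W \<omega> a x)))\<^sup>2 = 0"
      using that(1) fin
      by (simp add: sum_nonneg_eq_0_iff sum_nonneg wt_nonneg)
    with that(2) show ?thesis by simp
  qed
  \<comment> \<open>The line of \<open>F 1 1\<close> differs from that of \<open>\<phi> 1 2\<close>,
    so this test exposes a Kraus operator with a nonzero contribution, fixed from here on.\<close>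
  have "(\<Sum>\<omega>\<in>\<Omega>. \<Sum>a\<in>UNIV. \<Sum>x\<in>UNIV. wt 1 1 \<omega> a x * (cmod (bracket (\<phi> 1 2) (W \<omega> a x)))\<^sup>2) \<noteq> 0"
    using p t[of 1 1] \<phi>[of 2 1 1 1] by (simp add: sum_eq)
  then obtain \<omega> a0 x0 where \<omega>: "\<omega> \<in> \<Omega>" and "bracket (\<phi> 1 2) (W \<omega> a0 x0) \<noteq> 0"
    by (force elim!: sum.not_neutral_contains_not_neutral)
  define w where "w = W \<omega>"
  \<comment> \<open>\<open>Q\<close> is the quadratic form of the reduced state filtered by
    \<open>K \<omega>\<close>; by no-signaling it is the same for every input, which carries
    information from one input to the other.\<close>
  define Q where "Q u = (cmod (bracket u (w 1 x0)))\<^sup>2 + (cmod (bracket u (w 2 x0)))\<^sup>2" for u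
  have Q: "Q u = (cmod (bracket u (w 1 x)))\<^sup>2 + (cmod (bracket u (w 2 x)))\<^sup>2" for u x
  proof -
    have eq: "(\<Sum>a\<in>UNIV. E a x) = (\<Sum>a\<in>UNIV. E a x0)"
      using E unfolding assemblage_def by blast
    have "(\<Sum>a\<in>UNIV. ketbra (w a z)) = K \<omega> ** (\<Sum>a\<in>UNIV. E a z) ** hadjoint (K \<omega>)" for z
      by (simp add: w_def W_def sum_2 v matrix_add_ldistrib matrix_add_rdistrib conjugate_ketbra)
    then have "qform u (\<Sum>a\<in>UNIV. ketbra (w a x)) = qform u (\<Sum>a\<in>UNIV. ketbra (w a x0))"
      by (simp add: eq)
    then show ?thesis
      by (simp add: Q_def sum_2 qform_add qform_ketbra)
  qed
  have Q0: "Q u = 0 \<longleftrightarrow> (\<forall>a. bracket u (w a x) = 0)" for u x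
    by (simp add: Q[of u x] forall_2 add_nonneg_eq_0_iff)
  have Qnz: "Q (\<phi> 1 2) \<noteq> 0"
    using \<open>bracket (\<phi> 1 2) (W \<omega> a0 x0) \<noteq> 0\<close> Q0 unfolding w_def by blast
  \<comment> \<open>One choice of input and outcomes from the supports of the classical processing
    is enough: its weights are positive, so \<open>par0\<close> applies.\<close>
  have "\<forall>y. \<exists>x. pmf (PX y \<omega>) x > 0"
    using pmf_pos_exists by blast
  then obtain \<xi> where \<xi>: "\<And>y. pmf (PX y \<omega>) (\<xi> y) > 0"
    by metis
  have "\<exists>b. pmf (PA a (\<xi> y) \<omega> y) b > 0" for a y
    using pmf_pos_exists by blast
  then obtain \<beta> where \<beta>: "\<And>a y. pmf (PA a (\<xi> y) \<omega> y) (\<beta> a y) > 0"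
    by metis
  have par: "bracket (\<phi> (\<beta> a y) y) (w a (\<xi> y)) = 0" for a y
    unfolding w_def by (rule par0[OF \<omega>]) (simp add: wt_def \<xi> \<beta>)
  have \<phi>nz: "\<phi> b y \<noteq> 0" for b y
    using \<phi> ex_other[of y] by (metis bracket_zero_right)
  have "\<exists>c. w a (\<xi> y) = c *s \<phi> (\<beta> a y) y" for a y
    using bracket_eq_0_imp_parallel[OF par \<phi>nz] by metis
  then obtain c where c: "\<And>a y. w a (\<xi> y) = c a y *s \<phi> (\<beta> a y) y"
    by metis
  \<comment> \<open>Otherwise \<open>Q\<close> would put the vectors for \<open>\<xi> y'\<close> on
    the line of \<open>\<phi> b y\<close> too. They also lie on lines of target input
    \<open>y'\<close>, so they vanish, and with them \<open>Q\<close>.\<close>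
  have not_one_line: "\<not> (\<forall>a. bracket (\<phi> b y) (w a (\<xi> y)) = 0)" for b y
  proof
    assume "\<forall>a. bracket (\<phi> b y) (w a (\<xi> y)) = 0"
    then have Q1: "Q (\<phi> b y) = 0"
      using Q0 by blast
    obtain y' where y': "y' \<noteq> y"
      using ex_other by blast
    have "w a (\<xi> y') = 0" for a
    proof -
      have "bracket (\<phi> b y) (w a (\<xi> y')) = 0"
        using Q1 Q0 by blast
      then have "c a y' * bracket (\<phi> b y) (\<phi> (\<beta> a y') y') = 0"
        using bracket_scale[of 1 "\<phi> b y"] by (simp add: c)
      then have "c a y' = 0"
        using \<phi> y' by (metis mult_eq_0_iff)
      then show ?thesis by (simp add: c)
    qed
    then have "Q (\<phi> 1 2) = 0"
      by (simp add: Q[of _ "\<xi> y'"])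
    with Qnz show False ..
  qed
  \<comment> \<open>If one vector vanished, the line of the other would contain both.\<close>
  have c_nz: "c a y \<noteq> 0" for a y
  proof
    assume c0: "c a y = 0"
    obtain a' where a': "a' \<noteq> a" using ex_other by blast
    have "bracket (\<phi> (\<beta> a' y) y) (w b (\<xi> y)) = 0" for b
    proof (cases "b = a")
      case True
      then show ?thesis using c0 by (simp add: c)
    next
      case False
      then have "b = a'" using a' exhaust_2 by metis
      then show ?thesis by (simp add: par)
    qed
    with not_one_line show False by blast
  qed
  have \<beta>_inj: "\<beta> 1 y \<noteq> \<beta> 2 y" for y
  proof
    assume "\<beta> 1 y = \<beta> 2 y"
    then have "bracket (\<phi> (\<beta> 1 y) y) (w a (\<xi> y)) = 0" for a
      using exhaust_2[of a] par[of 1 y] par[of 2 y] by auto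
    with not_one_line show False by blast
  qed
  \<comment> \<open>A shared input would put one nonzero vector on lines of both target
    inputs.\<close>
  have \<xi>_inj: "\<xi> 1 \<noteq> \<xi> 2"
  proof
    assume "\<xi> 1 = \<xi> 2"
    then have "c 1 1 *s \<phi> (\<beta> 1 1) 1 = c 1 2 *s \<phi> (\<beta> 1 2) 2"
      by (metis c)
    then have "bracket (c 1 1 *s \<phi> (\<beta> 1 1) 1) (c 1 2 *s \<phi> (\<beta> 1 2) 2) = 0"
      by simp
    then show False
      using c_nz \<phi>[of 1 2] by (simp add: bracket_scale)
  qed
  have w: "w = (\<lambda>a x. K \<omega> *v v a x)"
    by (simp add: fun_eq_iff w_def W_def)
  show ?thesis
    by (rule that[OF _ cross_relabel[where w = w and \<xi> = \<xi> and c = c and \<phi> = \<phi> and \<beta> = \<beta>,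
          OF c \<xi>_inj \<beta>_inj, unfolded w cross_matrix_vector]])
       (simp add: c_nz)
qed

section \<open>A one-parameter family of targets\<close>

text \<open>Two orthogonal bases of the real plane, the second one unnormalised; \<open>m\<close>
  tunes the cross ratio to \<open>- m\<^sup>2\<close>.\<close>

definition target_vec :: "real \<Rightarrow> 2 \<Rightarrow> 2 \<Rightarrow> complex^2" where
  "target_vec m b y =
     (if y = 1 then (if b = 1 then vector [1, 0] else vector [0, 1])
      else (if b = 1 then vector [1, of_real m] else vector [of_real m, -1]))"

text \<open>Half the inverse squared norm of \<open>target_vec m b y\<close>. Each input thus yields
  half the projectors of an orthonormal basis, with the same sum for both inputs.\<close>

definition target_weight :: "real \<Rightarrow> 2 \<Rightarrow> 2 \<Rightarrow> real" where
  "target_weight m b y = (if y = 1 then 1 / 2 else 1 / (2 * (1 + m\<^sup>2)))"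

definition target :: "real \<Rightarrow> (2, 2, 2) family" where
  "target m b y = target_weight m b y *\<^sub>R ketbra (target_vec m b y)"

lemma target_weight_pos: "target_weight m b y > 0"
  using zero_le_power2[of m] by (simp add: target_weight_def add_pos_nonneg)

lemma sum_target: "(\<Sum>b\<in>UNIV. target m b y) = (1 / 2) *\<^sub>R mat 1"
proof (cases "y = 1")
  case True
  then show ?thesis
    by (simp add: target_def target_weight_def target_vec_def sum_2 vec_eq_iff forall_2
        ketbra_def mat_def)
next
  case False
  have "1 + m\<^sup>2 > 0"
    using zero_le_power2[of m] by linarith
  then have "(1 + m * m) / (2 * (1 + m\<^sup>2)) = 1 / 2"
    by (simp add: power2_eq_square)
  then have "1 / (2 * (1 + m\<^sup>2)) + m * m / (2 * (1 + m\<^sup>2)) = 1 / 2"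
    by (simp add: add_divide_distrib)
  with False show ?thesis
    by (simp add: target_def target_weight_def target_vec_def sum_2 vec_eq_iff forall_2
        ketbra_def mat_def complex_eq_iff power2_eq_square)
qed

lemma normalised_target: "normalised_assemblage (target m)"
  unfolding normalised_assemblage_def assemblage_def sum_target
  by (auto simp: target_def scaleR_ketbra psd_ketbra less_imp_le[OF target_weight_pos]
      trace_def sum_2 mat_def complex_eq_iff)

lemma cross_target: "cross1 (target_vec m) = - (of_real m)\<^sup>2" "cross2 (target_vec m) = 1"
  by (simp_all add: cross1_def cross2_def bracket_def target_vec_def power2_eq_square)

lemma bracket_target:
  assumes "m \<noteq> 0" "y \<noteq> y'"
  shows "bracket (target_vec m b y) (target_vec m b' y') \<noteq> 0"
  using assms exhaust_2[of y] exhaust_2[of y']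
  by (auto simp: bracket_def target_vec_def)

theorem theorem5:
  shows "\<not> (\<exists>\<Psi> :: (2, 2, 2) family. pure_assemblage \<Psi> \<and>
           (\<forall>F :: (2, 2, 2) family. normalised_assemblage F \<longrightarrow> transformable \<Psi> F))"
proof
  assume "\<exists>\<Psi> :: (2, 2, 2) family. pure_assemblage \<Psi> \<and>
           (\<forall>F :: (2, 2, 2) family. normalised_assemblage F \<longrightarrow> transformable \<Psi> F)"
  then obtain \<Psi> :: "(2, 2, 2) family" where pure: "pure_assemblage \<Psi>"
    and all: "\<And>F :: (2, 2, 2) family. normalised_assemblage F \<Longrightarrow> transformable \<Psi> F"
    by blast
  have assm: "assemblage \<Psi>"
    using pure by (simp add: pure_assemblage_def normalised_assemblage_def)
  obtain v where v: "\<And>a x. \<Psi> a x = ketbra (v a x)"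
    using pure_assemblageE[OF pure] by blast
  note inv = cross_ratio_invariant[OF assm v target_def target_weight_pos bracket_target
      all[OF normalised_target]]
  have ratio: "\<exists>k l. l \<noteq> 0 \<and>
      (k * cross1 v = - l * (of_real m)\<^sup>2 \<and> k * cross2 v = l \<or>
       k * cross1 v = l \<and> k * cross2 v = - l * (of_real m)\<^sup>2)" if "m \<noteq> 0" for m
    by (rule inv[OF that]) (auto simp: cross_target)
  \<comment> \<open>The cross ratio -1 is its own inverse, so both alternatives give
    \<open>cross1 v = - cross2 v\<close>.\<close>
  obtain k l where 1: "l \<noteq> 0" "k * cross1 v = - l \<and> k * cross2 v = l \<or>
      k * cross1 v = l \<and> k * cross2 v = - l"
    using ratio[of 1] by auto
  \<comment> \<open>Here the cross ratio is -4 or -1/4, never -1: inserting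
    \<open>cross1 v = - cross2 v\<close> yields \<open>4 * l' = l'\<close>, against
    \<open>l' \<noteq> 0\<close>.\<close>
  obtain k' l' where 2: "l' \<noteq> 0" "k' * cross1 v = - (4 * l') \<and> k' * cross2 v = l' \<or>
      k' * cross1 v = l' \<and> k' * cross2 v = - (4 * l')"
    using ratio[of 2] by (auto simp: mult.commute)
  have "k * (cross1 v + cross2 v) = 0" "k \<noteq> 0"
    using 1 by (auto simp: algebra_simps)
  then have "cross1 v = - cross2 v"
    by (simp add: add_eq_0_iff2)
  with 2 show False
    by auto
qed

end
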